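(* Let $S$ be a finite or countably infinite set, let $B=(B(x,y):x,y\in S)$ be an irreducible sub-stochastic matrix, and fix $z\in S$. Let $X$, $T$, $\tau$, $P_x$, $E_x$ be as in the context. Suppose that $\theta\ge 0$ satisfies $$E_z e^{\theta\tau}I(T>\tau)=1 .$$ Set $\lambda_*=e^{-\theta}$ and, for $x,y\in S$, $$u_*(x)=E_x e^{\theta\tau}I(T>\tau),\qquad \eta_*(y)=E_z\sum_{j=0}^{\tau-1}e^{\theta j}I(X_j=y,\;T>j).$$ Then $u_*=(u_*(x):x\in S)$ and $\eta_*=(\eta_*(y):y\in S)$ are (strictly) positive finite-valued column and row vectors, respectively, and $$Bu_*=\lambda_*u_*,\qquad \eta_*B=\lambda_*\eta_* .$$
   Context: A matrix $B=(B(x,y):x,y\in S)$ is sub-stochastic if $B(x,y)\ge 0$ and $\sum_{y\in S}B(x,y)\le 1$ for all $x\in S$. It is irreducible if for all $x,y\in S$ there is $n=n(x,y)\ge 1$ with $B^n(x,y)>0$. Column vectors are acted on by $(Bu)(x)=\sum_{y\in S}B(x,y)u(y)$ and row vectors by $(\eta B)(y)=\sum_{x\in S}\eta(x)B(x,y)$. Let $\Delta\notin S$, $S_\Delta=S\cup\{\Delta\}$, and let $P$ be the stochastic matrix on $S_\Delta$ given by $P(x,y)=B(x,y)$ for $x,y\in S$; $P(x,\Delta)=1-\sum_{y\in S}B(x,y)$ for $x\in S$; $P(\Delta,\Delta)=1$; $P(\Delta,y)=0$ for $y\in S$. Let $X=(X_n:n\ge 0)$ be the Markov chain on $S_\Delta$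 with transition matrix $P$; $P_x$ and $E_x$ denote probability and expectation given $X_0=x$. Let $T=\inf\{n\ge 0:X_n=\Delta\}$ and, for the fixed $z\in S$, $\tau=\inf\{n\ge 1:X_n=z\}$ (with $\inf\emptyset=\infty$). $I(\cdot)$ is the indicator, and $I(T>\tau)$ is interpreted as $\sum_{k=1}^\infty I(\tau=k,\,T>k)$, so that $\tau$ is finite on $\{T>\tau\}$ (even when $T=\infty$); thus $E_xe^{\theta\tau}I(T>\tau)=\sum_{k\ge1}e^{\theta k}P_x(\tau=k,T>k)$. *)

theory Defs
  imports "HOL-Probability.Probability" "HOL-Library.Extended_Nat"
begin

definition sub_stochastic :: "'a set \<Rightarrow> ('a \<Rightarrow> 'a \<Rightarrow> real) \<Rightarrow> bool" where
  "sub_stochastic S B \<longleftrightarrow>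
     (\<forall>x\<in>S. \<forall>y\<in>S. 0 \<le> B x y) \<and>
     (\<forall>x\<in>S. (\<lambda>y. B x y) summable_on S \<and> (\<Sum>\<^sub>\<infinity>y\<in>S. B x y) \<le> 1)"

text \<open>For sub-stochastic \<open>B\<close> all sums below converge, so the real-valued \<^const>\<open>infsum\<close> never takes
  its default value.\<close>

fun mat_pow :: "'a set \<Rightarrow> ('a \<Rightarrow> 'a \<Rightarrow> real) \<Rightarrow> nat \<Rightarrow> 'a \<Rightarrow> 'a \<Rightarrow> real" where
  "mat_pow S B 0 x y = (if x = y then 1 else 0)"
| "mat_pow S B (Suc n) x y = (\<Sum>\<^sub>\<infinity>w\<in>S. B x w * mat_pow S B n w y)"

definition irreducible_matrix :: "'a set \<Rightarrow> ('a \<Rightarrow> 'a \<Rightarrow> real) \<Rightarrow> bool" where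
  "irreducible_matrix S B \<longleftrightarrow> (\<forall>x\<in>S. \<forall>y\<in>S. \<exists>n\<ge>1. 0 < mat_pow S B n x y)"

text \<open>Vectors are extended-nonnegative valued, since their finiteness is something to be proved;
  sums over \<open>S\<close> are then always defined.\<close>

definition mat_col :: "'a set \<Rightarrow> ('a \<Rightarrow> 'a \<Rightarrow> real) \<Rightarrow> ('a \<Rightarrow> ennreal) \<Rightarrow> 'a \<Rightarrow> ennreal" where
  "mat_col S B u x = (\<Sum>\<^sub>\<infinity>y\<in>S. ennreal (B x y) * u y)"

definition row_mat :: "'a set \<Rightarrow> ('a \<Rightarrow> ennreal) \<Rightarrow> ('a \<Rightarrow> 'a \<Rightarrow> real) \<Rightarrow> 'a \<Rightarrow> ennreal" where
  "row_mat S \<eta> B y = (\<Sum>\<^sub>\<infinity>x\<in>S. \<eta> x * ennreal (B x y))"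

text \<open>The cemetery state \<open>\<Delta>\<close> is \<^const>\<open>None\<close>.\<close>

definition ext_states :: "'a set \<Rightarrow> 'a option set" where
  "ext_states S = insert None (Some ` S)"

fun ext_matrix :: "'a set \<Rightarrow> ('a \<Rightarrow> 'a \<Rightarrow> real) \<Rightarrow> 'a option \<Rightarrow> 'a option \<Rightarrow> real" where
  "ext_matrix S B (Some x) (Some y) = B x y"
| "ext_matrix S B (Some x) None = 1 - (\<Sum>\<^sub>\<infinity>y\<in>S. B x y)"
| "ext_matrix S B None None = 1"
| "ext_matrix S B None (Some y) = 0"

definition markov_chain ::
  "'s set \<Rightarrow> ('s \<Rightarrow> 's \<Rightarrow> real) \<Rightarrow> 'w measure \<Rightarrow> (nat \<Rightarrow> 'w \<Rightarrow> 's) \<Rightarrow> bool" where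
  "markov_chain E P M X \<longleftrightarrow>
     prob_space M \<and>
     (\<forall>n. X n \<in> measurable M (count_space E)) \<and>
     (\<forall>n s. (\<forall>i\<le>Suc n. s i \<in> E) \<longrightarrow>
        \<P>(\<omega> in M. \<forall>i\<le>n. X i \<omega> = s i) \<noteq> 0 \<longrightarrow>
        \<P>(\<omega> in M. X (Suc n) \<omega> = s (Suc n) \<bar> \<forall>i\<le>n. X i \<omega> = s i) = P (s n) (s (Suc n)))"

text \<open>The law \<open>P\<^sub>x\<close> is the measure \<open>Pr x\<close>; all laws share the same process \<open>X\<close>.\<close>

definition markov_family ::
  "'s set \<Rightarrow> ('s \<Rightarrow> 's \<Rightarrow> real) \<Rightarrow> ('s \<Rightarrow> 'w measure) \<Rightarrow> (nat \<Rightarrow> 'w \<Rightarrow> 's) \<Rightarrow> bool" where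
  "markov_family E P Pr X \<longleftrightarrow>
     (\<forall>x\<in>E. markov_chain E P (Pr x) X \<and> \<P>(\<omega> in Pr x. X 0 \<omega> = x) = 1)"

text \<open>In \<^typ>\<open>enat\<close>, the infimum of the empty set is \<open>\<infinity>\<close>.\<close>

definition death_time :: "(nat \<Rightarrow> 'w \<Rightarrow> 'a option) \<Rightarrow> 'w \<Rightarrow> enat" where
  "death_time X \<omega> = Inf (enat ` {n. X n \<omega> = None})"

definition return_time :: "(nat \<Rightarrow> 'w \<Rightarrow> 'a option) \<Rightarrow> 'a \<Rightarrow> 'w \<Rightarrow> enat" where
  "return_time X z \<omega> = Inf (enat ` {n. 1 \<le> n \<and> X n \<omega> = Some z})"

text \<open>If \<open>return_time X z \<omega> < death_time X \<omega>\<close> then the return time is finite (the death time may be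
  \<open>\<infinity>\<close>), so \<^const>\<open>the_enat\<close> is applied to finite values only.\<close>

definition u_star ::
  "('a option \<Rightarrow> 'w measure) \<Rightarrow> (nat \<Rightarrow> 'w \<Rightarrow> 'a option) \<Rightarrow> 'a \<Rightarrow> real \<Rightarrow> 'a \<Rightarrow> ennreal" where
  "u_star Pr X z \<theta> x =
     (\<integral>\<^sup>+\<omega>. (if return_time X z \<omega> < death_time X \<omega>
              then ennreal (exp (\<theta> * real (the_enat (return_time X z \<omega>)))) else 0) \<partial>Pr (Some x))"

definition eta_star ::
  "('a option \<Rightarrow> 'w measure) \<Rightarrow> (nat \<Rightarrow> 'w \<Rightarrow> 'a option) \<Rightarrow> 'a \<Rightarrow> real \<Rightarrow> 'a \<Rightarrow> ennreal" where
  "eta_star Pr X z \<theta> y =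
     (\<integral>\<^sup>+\<omega>. (\<Sum>j. if enat j < return_time X z \<omega> \<and> X j \<omega> = Some y \<and> enat j < death_time X \<omega>
                  then ennreal (exp (\<theta> * real j)) else 0) \<partial>Pr (Some z))"

end

theory Submission imports Defs begin

text \<open>Let \<open>K\<close> be \<open>B\<close> with the column of \<open>z\<close> set to zero. Decomposing over paths,
  \<open>\<eta>\<^sub>*(y) = \<Sum>\<^sub>j e\<^sup>\<theta>\<^sup>j K\<^sup>j(z,y)\<close> and
  \<open>u\<^sub>*(x) = \<Sum>\<^sub>k e\<^sup>\<theta>\<^sup>(\<^sup>k\<^sup>+\<^sup>1\<^sup>) (K\<^sup>k B)(x,z)\<close>. Shifting the
  summation index by one gives both eigenvector equations; the hypothesis \<open>u\<^sub>*(z) = 1\<close> is what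
  closes them at the state \<open>z\<close>. All sums have values in \<open>[0,\<infinity>]\<close>, so no convergence is needed.
  Afterwards positivity and finiteness spread from \<open>u\<^sub>*(z) = \<eta>\<^sub>*(z) = 1\<close> along edges
  \<open>B(x,w) > 0\<close>, because \<open>B(x,w) u\<^sub>*(w) \<le> \<lambda>\<^sub>* u\<^sub>*(x)\<close> and
  \<open>\<eta>\<^sub>*(x) B(x,w) \<le> \<lambda>\<^sub>* \<eta>\<^sub>*(w)\<close>.\<close>

section \<open>Countable sums in [0,\<infinity>] as integrals\<close>

text \<open>\<open>mat_col\<close> and \<open>row_mat\<close> use \<open>infsum\<close>, while
  monotone convergence and the exchange of sums are applied to \<open>nn_integral\<close>. For
  infinite \<open>S\<close> both are carried to the naturals along an enumeration.\<close>

lemma infsum_ennreal_eq_nn_integral: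
  fixes f :: "'a \<Rightarrow> ennreal"
  assumes "countable S"
  shows "(\<Sum>\<^sub>\<infinity>x\<in>S. f x) = (\<integral>\<^sup>+x. f x \<partial>count_space S)"
proof (cases "finite S")
  case True
  then show ?thesis by (simp add: nn_integral_count_space_finite)
next
  case False
  have bij: "bij_betw (from_nat_into S) UNIV S"
    using assms False by (rule bij_betw_from_nat_into)
  have "(\<Sum>\<^sub>\<infinity>x\<in>S. f x) = (\<Sum>\<^sub>\<infinity>n\<in>UNIV. f (from_nat_into S n))"
    by (rule infsum_reindex_bij_betw[OF bij, symmetric])
  also have "\<dots> = (\<Sum>n. f (from_nat_into S n))"
    by (intro sums_unique has_sum_imp_sums has_sum_infsum nonneg_summable_on_complete) simp
  also have "\<dots> = (\<integral>\<^sup>+n. f (from_nat_into S n) \<partial>count_space UNIV)"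
    by (simp add: nn_integral_count_space_nat)
  also have "\<dots> = (\<integral>\<^sup>+x. f x \<partial>count_space S)"
    by (rule nn_integral_bij_count_space[OF bij])
  finally show ?thesis .
qed

lemma nn_integral_count_space_delta:
  fixes f :: "'a \<Rightarrow> ennreal"
  assumes "x \<in> S"
  shows "(\<integral>\<^sup>+y. (if y = x then f y else 0) \<partial>count_space S) = f x"
  using assms by (subst nn_integral_count_space'[where A="{x}"]) auto

lemma suminf_split_head_ennreal:
  fixes f :: "nat \<Rightarrow> ennreal"
  shows "(\<Sum>n. f n) = f 0 + (\<Sum>n. f (Suc n))"
  using suminf_offset[of f 1] by (simp add: ac_simps)

section \<open>The Markov property relative to an event of the past\<close>

text \<open>\<open>markov_chain\<close> conditions on a single trajectory of positive probability.
  Countably many trajectories up to time \<open>n\<close> make up the past event, so summing over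
  them gives the identity for an arbitrary predicate \<Phi> of the past.\<close>

lemma markov_chain_step:
  assumes mc: "markov_chain E P M X" and E: "countable E" and w: "w \<in> E" and v: "v \<in> E"
  shows "emeasure M {\<omega>\<in>space M. \<Phi> (\<lambda>i\<in>{..n}. X i \<omega>) \<and> X n \<omega> = w \<and> X (Suc n) \<omega> = v}
    = emeasure M {\<omega>\<in>space M. \<Phi> (\<lambda>i\<in>{..n}. X i \<omega>) \<and> X n \<omega> = w} * ennreal (P w v)"
proof -
  interpret prob_space M using mc by (simp add: markov_chain_def)
  have X [measurable]: "X i \<in> measurable M (count_space E)" for i
    using mc by (simp add: markov_chain_def)
  have XE: "X i \<omega> \<in> E" if "\<omega> \<in> space M" for i \<omega>
    using measurable_space[OF X that] by simp
  have ev [measurable]: "{\<omega>\<in>space M. X i \<omega> = e} \<in> sets M" if "e \<in> E" for i e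
  proof -
    have "X i -` {e} \<inter> space M \<in> sets M" using that by measurable
    also have "X i -` {e} \<inter> space M = {\<omega>\<in>space M. X i \<omega> = e}" by auto
    finally show ?thesis .
  qed
  \<comment> \<open>Extensional functions represent each trajectory exactly once and form a
    countable set, being a finite product of copies of \<open>E\<close>.\<close>
  define I where "I = {s \<in> {..n} \<rightarrow>\<^sub>E E. \<Phi> s \<and> s n = w}"
  have I: "countable I" unfolding I_def
    by (rule countable_subset[OF _ countable_PiE[of "{..n}" "\<lambda>_. E"]]) (use E in auto)
  define H where "H s = {\<omega>\<in>space M. \<forall>i\<le>n. X i \<omega> = s i}" for s
  have path: "(\<lambda>i\<in>{..n}. X i \<omega>) = s \<longleftrightarrow> (\<forall>i\<le>n. X i \<omega> = s i)" if "s \<in> I" for s \<omega>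
    using that unfolding I_def by (auto simp: fun_eq_iff restrict_def PiE_def extensional_def)
  have in_I: "(\<lambda>i\<in>{..n}. X i \<omega>) \<in> I" if "\<omega> \<in> space M" "\<Phi> (\<lambda>i\<in>{..n}. X i \<omega>)" "X n \<omega> = w" for \<omega>
    using that XE[OF that(1)] by (simp add: I_def restrict_PiE_iff)
  have HS: "H s \<in> sets M" if "s \<in> I" for s
  proof -
    have "{\<omega>\<in>space M. \<forall>i\<in>{..n}. X i \<omega> = s i} \<in> sets M"
      using that by (intro sets.sets_Collect_finite_All ev) (auto simp: I_def)
    then show ?thesis by (simp add: H_def Ball_def)
  qed
  have disj: "disjoint_family_on H I"
  proof (unfold disjoint_family_on_def, intro ballI impI)
    fix s t assume st: "s \<in> I" "t \<in> I" "s \<noteq> t"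
    have "s = t" if "\<omega> \<in> H s" "\<omega> \<in> H t" for \<omega>
    proof -
      have "(\<lambda>i\<in>{..n}. X i \<omega>) = s" using path[OF st(1)] that by (simp add: H_def)
      moreover have "(\<lambda>i\<in>{..n}. X i \<omega>) = t" using path[OF st(2)] that by (simp add: H_def)
      ultimately show ?thesis by simp
    qed
    then show "H s \<inter> H t = {}" using st by blast
  qed
  have step: "emeasure M (H s \<inter> {\<omega>\<in>space M. X (Suc n) \<omega> = v}) = emeasure M (H s) * ennreal (P w v)"
    if s: "s \<in> I" for s
  \<comment> \<open>On a null trajectory the definition of the chain says nothing, but both sides
    vanish.\<close>
  proof (cases "measure M (H s) = 0")
    case True
    then have "emeasure M (H s) = 0" by (simp add: emeasure_eq_measure)
    moreover have "emeasure M (H s \<inter> {\<omega>\<in>space M. X (Suc n) \<omega> = v}) \<le> emeasure M (H s)"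
      using HS[OF s] by (intro emeasure_mono) auto
    ultimately show ?thesis by simp
  next
    case False
    \<comment> \<open>\<open>s\<close> is \<open>undefined\<close> at \<open>Suc n\<close>; the
      update inserts the target state there and leaves the conditioning event unchanged.\<close>
    define s' where "s' = s(Suc n := v)"
    have H': "{\<omega>\<in>space M. \<forall>i\<le>n. X i \<omega> = s' i} = H s"
      unfolding H_def s'_def by auto
    have s'E: "\<forall>i\<le>Suc n. s' i \<in> E"
      using s v unfolding I_def s'_def by (auto simp: le_Suc_eq)
    have "\<P>(\<omega> in M. X (Suc n) \<omega> = s' (Suc n) \<bar> \<forall>i\<le>n. X i \<omega> = s' i) = P (s' n) (s' (Suc n))"
      using mc s'E False H' unfolding markov_chain_def by auto
    moreover have "{\<omega>\<in>space M. X (Suc n) \<omega> = s' (Suc n) \<and> (\<forall>i\<le>n. X i \<omega> = s' i)}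
        = H s \<inter> {\<omega>\<in>space M. X (Suc n) \<omega> = v}"
      using H' by (auto simp: s'_def)
    ultimately have "P w v = measure M (H s \<inter> {\<omega>\<in>space M. X (Suc n) \<omega> = v}) / measure M (H s)"
      using s unfolding cond_prob_def H' by (simp add: s'_def I_def)
    then show ?thesis using False
      by (simp add: emeasure_eq_measure ennreal_mult[symmetric])
  qed
  have eq: "{\<omega>\<in>space M. \<Phi> (\<lambda>i\<in>{..n}. X i \<omega>) \<and> X n \<omega> = w} = (\<Union>s\<in>I. H s)"
  proof (intro set_eqI iffI)
    fix \<omega> assume a: "\<omega> \<in> {\<omega>\<in>space M. \<Phi> (\<lambda>i\<in>{..n}. X i \<omega>) \<and> X n \<omega> = w}"
    then show "\<omega> \<in> (\<Union>s\<in>I. H s)"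
      by (intro UN_I[OF in_I]) (auto simp: H_def)
  next
    fix \<omega> assume "\<omega> \<in> (\<Union>s\<in>I. H s)"
    then obtain s where s: "s \<in> I" "\<omega> \<in> space M" "\<forall>i\<le>n. X i \<omega> = s i" by (auto simp: H_def)
    then have "(\<lambda>i\<in>{..n}. X i \<omega>) = s" using path by blast
    then show "\<omega> \<in> {\<omega>\<in>space M. \<Phi> (\<lambda>i\<in>{..n}. X i \<omega>) \<and> X n \<omega> = w}" using s by (auto simp: I_def)
  qed
  have "{\<omega>\<in>space M. \<Phi> (\<lambda>i\<in>{..n}. X i \<omega>) \<and> X n \<omega> = w \<and> X (Suc n) \<omega> = v}
      = (\<Union>s\<in>I. H s \<inter> {\<omega>\<in>space M. X (Suc n) \<omega> = v})"
    using eq by blast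
  also have "emeasure M \<dots> = (\<integral>\<^sup>+s. emeasure M (H s \<inter> {\<omega>\<in>space M. X (Suc n) \<omega> = v}) \<partial>count_space I)"
    using HS I disj v by (intro emeasure_UN_countable sets.Int ev) (auto simp: disjoint_family_on_def)
  also have "\<dots> = (\<integral>\<^sup>+s. emeasure M (H s) * ennreal (P w v) \<partial>count_space I)"
    using step by (intro nn_integral_cong) simp
  also have "\<dots> = (\<integral>\<^sup>+s. emeasure M (H s) \<partial>count_space I) * ennreal (P w v)"
    by (rule nn_integral_multc) simp
  also have "(\<integral>\<^sup>+s. emeasure M (H s) \<partial>count_space I) = emeasure M (\<Union>s\<in>I. H s)"
    using HS I disj by (intro emeasure_UN_countable[symmetric]) auto
  finally show ?thesis unfolding eq .
qed

section \<open>The taboo kernel K and its powers\<close>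

definition taboo_op :: "'a set \<Rightarrow> ('a \<Rightarrow> 'a \<Rightarrow> real) \<Rightarrow> 'a \<Rightarrow> ('a \<Rightarrow> ennreal) \<Rightarrow> 'a \<Rightarrow> ennreal" where
  "taboo_op S B z g x = (\<integral>\<^sup>+y. ennreal (B x y) * (if y = z then 0 else g y) \<partial>count_space S)"

text \<open>The entries of K^n, built by appending a last step because
  \<open>markov_chain_step\<close> extends a path at its end. Time 0 is exempt from the taboo, so a
  path may start at \<open>z\<close>.\<close>

fun taboo_prob :: "'a set \<Rightarrow> ('a \<Rightarrow> 'a \<Rightarrow> real) \<Rightarrow> 'a \<Rightarrow> nat \<Rightarrow> 'a \<Rightarrow> 'a \<Rightarrow> ennreal" where
  "taboo_prob S B z 0 x y = (if x = y then 1 else 0)"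
| "taboo_prob S B z (Suc n) x y =
     (if y = z then 0 else \<integral>\<^sup>+w. taboo_prob S B z n x w * ennreal (B w y) \<partial>count_space S)"

text \<open>Forward and backward recursion agree, which replaces the Markov property at time 1.\<close>

lemma taboo_prob_duality:
  assumes S: "countable S" and x: "x \<in> S"
  shows "(\<integral>\<^sup>+w. taboo_prob S B z n x w * g w \<partial>count_space S) = (taboo_op S B z ^^ n) g x"
proof (induction n arbitrary: g)
  case 0
  have "(\<integral>\<^sup>+w. taboo_prob S B z 0 x w * g w \<partial>count_space S)
      = (\<integral>\<^sup>+w. (if w = x then g w else 0) \<partial>count_space S)"
    by (intro nn_integral_cong) auto
  then show ?case using x by (simp add: nn_integral_count_space_delta)
next
  case (Suc n)
  \<comment> \<open>The taboo on the last state moves from the kernel to the test function: K^(n+1)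
    g = K^n (K g). The induction hypothesis is then applied to K g in place of
    \<open>g\<close>.\<close>
  have "(\<integral>\<^sup>+w. taboo_prob S B z (Suc n) x w * g w \<partial>count_space S)
      = (\<integral>\<^sup>+w. \<integral>\<^sup>+v. taboo_prob S B z n x v * (ennreal (B v w) * (if w = z then 0 else g w))
           \<partial>count_space S \<partial>count_space S)"
    by (intro nn_integral_cong) (auto simp: nn_integral_multc[symmetric] mult.assoc)
  also have "\<dots> = (\<integral>\<^sup>+v. \<integral>\<^sup>+w. taboo_prob S B z n x v * (ennreal (B v w) * (if w = z then 0 else g w))
           \<partial>count_space S \<partial>count_space S)"
    using S by (rule nn_integral_count_space_nn_integral) simp
  also have "\<dots> = (\<integral>\<^sup>+v. taboo_prob S B z n x v * taboo_op S B z g v \<partial>count_space S)"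
    unfolding taboo_op_def by (simp add: nn_integral_cmult)
  also have "\<dots> = (taboo_op S B z ^^ Suc n) g x"
    by (simp add: Suc.IH funpow_swap1)
  finally show ?case .
qed

lemma taboo_op_suminf:
  "taboo_op S B z (\<lambda>y. \<Sum>k. f k y) x = (\<Sum>k. taboo_op S B z (f k) x)"
proof -
  have "taboo_op S B z (\<lambda>y. \<Sum>k. f k y) x
      = (\<integral>\<^sup>+y. (\<Sum>k. ennreal (B x y) * (if y = z then 0 else f k y)) \<partial>count_space S)"
    unfolding taboo_op_def by (intro nn_integral_cong) (auto simp: ennreal_suminf_cmult)
  also have "\<dots> = (\<Sum>k. \<integral>\<^sup>+y. ennreal (B x y) * (if y = z then 0 else f k y) \<partial>count_space S)"
    by (rule nn_integral_suminf) simp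
  finally show ?thesis unfolding taboo_op_def .
qed

lemma taboo_op_cmult: "taboo_op S B z (\<lambda>y. c * g y) x = c * taboo_op S B z g x"
  unfolding taboo_op_def
  by (simp add: nn_integral_cmult[symmetric]) (auto intro!: nn_integral_cong simp: ac_simps)

section \<open>From irreducibility to paths of positive entries\<close>

lemma mat_pow_nonneg:
  assumes "sub_stochastic S B" "x \<in> S" "y \<in> S"
  shows "0 \<le> mat_pow S B n x y"
  using assms(2)
proof (induction n arbitrary: x)
  case (Suc n)
  then show ?case using assms by (auto intro!: infsum_nonneg simp: sub_stochastic_def)
qed simp

text \<open>A positive sum has a nonzero summand, and nonnegativity makes both of its factors
  positive, which yields the first edge. This lets irreducibility be used by induction along
  edges.\<close>

lemma mat_pow_pos_path:
  assumes B: "sub_stochastic S B" and y: "y \<in> S" and "x \<in> S" and "0 < mat_pow S B n x y"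
  shows "(x, y) \<in> {(v, w). v \<in> S \<and> w \<in> S \<and> 0 < B v w}\<^sup>*"
  using assms(3,4)
proof (induction n arbitrary: x)
  case (Suc n)
  have "\<not> (\<forall>w\<in>S. B x w * mat_pow S B n w y = 0)"
    using Suc.prems(2) infsum_0[of S "\<lambda>w. B x w * mat_pow S B n w y"] by auto
  then obtain w where w: "w \<in> S" "B x w \<noteq> 0" "mat_pow S B n w y \<noteq> 0" by auto
  then have "0 < B x w" "0 < mat_pow S B n w y"
    using B Suc.prems(1) mat_pow_nonneg[OF B w(1) y, of n] by (auto simp: sub_stochastic_def less_le)
  then show ?case
    using Suc.IH[OF w(1)] Suc.prems(1) w(1) by (auto intro: converse_rtrancl_into_rtrancl)
qed (simp split: if_splits)


section \<open>Return and death times as conditions on the path\<close>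

lemma enat_less_Inf_enat_image_iff: "enat n < Inf (enat ` A) \<longleftrightarrow> (\<forall>a\<in>A. n < a)"
proof
  show "\<forall>a\<in>A. n < a" if "enat n < Inf (enat ` A)"
    using that by (metis Inf_lower enat_ord_simps(2) imageI order_less_le_trans)
  show "enat n < Inf (enat ` A)" if A: "\<forall>a\<in>A. n < a"
  proof (cases "A = {}")
    case True
    then show ?thesis by (simp add: Inf_enat_def)
  next
    case False
    then have "Inf (enat ` A) \<in> enat ` A"
      unfolding Inf_enat_def by (auto intro: LeastI)
    then show ?thesis using A by auto
  qed
qed

text \<open>The event that both \<tau> and T exceed \<open>n\<close>, expressed through the
  coordinates up to \<open>n\<close> so that it can serve as \<Phi> in
  \<open>markov_chain_step\<close>.\<close>

definition avoids :: "'a \<Rightarrow> nat \<Rightarrow> (nat \<Rightarrow> 'a option) \<Rightarrow> bool" where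
  "avoids z n s \<longleftrightarrow> (\<forall>i\<le>n. s i \<noteq> None) \<and> (\<forall>i\<in>{1..n}. s i \<noteq> Some z)"

lemma avoids_restrict: "avoids z n (\<lambda>i\<in>{..n}. s i) \<longleftrightarrow> avoids z n s"
  by (auto simp: avoids_def)

lemma avoids_Suc:
  "avoids z (Suc n) s \<longleftrightarrow> avoids z n s \<and> s (Suc n) \<noteq> None \<and> s (Suc n) \<noteq> Some z"
  proof -
  have "{1..Suc n} = insert (Suc n) {1..n}" by (rule atLeastAtMostSuc_conv) simp
  then show ?thesis by (auto simp: avoids_def le_Suc_eq)
qed

lemma avoids_iff_times:
  "avoids z n (\<lambda>i. X i \<omega>) \<longleftrightarrow> enat n < return_time X z \<omega> \<and> enat n < death_time X \<omega>"
  unfolding avoids_def return_time_def death_time_def enat_less_Inf_enat_image_iff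
  by (auto simp: not_le[symmetric])

lemma return_time_eq_Suc_iff:
  "return_time X z \<omega> = enat (Suc k) \<and> return_time X z \<omega> < death_time X \<omega>
    \<longleftrightarrow> avoids z k (\<lambda>i. X i \<omega>) \<and> X (Suc k) \<omega> = Some z"
proof -
  \<comment> \<open>Equality is rewritten by strict comparisons, the form that
    \<open>enat_less_Inf_enat_image_iff\<close> handles.\<close>
  have 1: "r = enat (Suc k) \<longleftrightarrow> enat k < r \<and> \<not> enat (Suc k) < r" for r
    by (cases r) auto
  have 2: "(\<forall>a\<in>{i. X i \<omega> = None}. Suc k < a) \<longleftrightarrow> (\<forall>i\<le>k. X i \<omega> \<noteq> None) \<and> X (Suc k) \<omega> \<noteq> None"
    by (auto simp: not_le[symmetric] le_Suc_eq)
  have 3: "(\<forall>a\<in>{i. 1 \<le> i \<and> X i \<omega> = Some z}. n < a) \<longleftrightarrow> (\<forall>i\<in>{1..n}. X i \<omega> \<noteq> Some z)" for n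
    by (auto simp: not_le[symmetric])
  have "return_time X z \<omega> = enat (Suc k) \<and> return_time X z \<omega> < death_time X \<omega>
      \<longleftrightarrow> return_time X z \<omega> = enat (Suc k) \<and> enat (Suc k) < death_time X \<omega>"
    by auto
  also have "\<dots> \<longleftrightarrow> avoids z k (\<lambda>i. X i \<omega>) \<and> X (Suc k) \<omega> = Some z"
    unfolding 1 return_time_def death_time_def enat_less_Inf_enat_image_iff 2 3 avoids_def
    using atLeastAtMostSuc_conv[of 1 k] by auto
  finally show ?thesis .
qed

text \<open>At most one summand is nonzero, namely the one with \<tau> = k + 1. The shift of the
  index reflects that \<tau> is at least 1.\<close>

lemma return_before_death_suminf:
  fixes c :: "nat \<Rightarrow> ennreal"
  shows "(if return_time X z \<omega> < death_time X \<omega> then c (the_enat (return_time X z \<omega>)) else 0)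
    = (\<Sum>k. if avoids z k (\<lambda>i. X i \<omega>) \<and> X (Suc k) \<omega> = Some z then c (Suc k) else 0)"
proof (cases "return_time X z \<omega> < death_time X \<omega>")
  case False
  then show ?thesis by (simp flip: return_time_eq_Suc_iff)
next
  case True
  then obtain m where m: "return_time X z \<omega> = enat m"
    by (metis enat_ord_simps(6) not_enat_eq)
  have "enat 0 < return_time X z \<omega>"
    unfolding return_time_def enat_less_Inf_enat_image_iff by auto
  then obtain k where k: "m = Suc k" using m by (cases m) auto
  show ?thesis unfolding return_time_eq_Suc_iff[symmetric]
    using True m k by (subst suminf_finite[of "{k}"]) auto
qed

section \<open>Path expansions of \<open>u_star\<close> and \<open>eta_star\<close>\<close>

context
  fixes S :: "'a set" and B :: "'a \<Rightarrow> 'a \<Rightarrow> real" and z :: 'a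
    and Pr :: "'a option \<Rightarrow> 'w measure" and X :: "nat \<Rightarrow> 'w \<Rightarrow> 'a option"
  assumes S: "countable S" and z: "z \<in> S"
    and mf: "markov_family (ext_states S) (ext_matrix S B) Pr X"
begin

lemma measurable_history:
  assumes "x \<in> S"
  shows "{\<omega>\<in>space (Pr (Some x)). avoids z n (\<lambda>i. X i \<omega>) \<and> X m \<omega> = e} \<in> sets (Pr (Some x))"
proof -
  have X: "X i \<in> Pr (Some x) \<rightarrow>\<^sub>M count_space (ext_states S)" for i
    using mf assms by (auto simp: markov_family_def markov_chain_def ext_states_def)
  have [measurable]: "Measurable.pred (Pr (Some x)) (\<lambda>\<omega>. X i \<omega> = a)" for i a
    by (rule measurable_compose[OF X]) simp
  show ?thesis unfolding avoids_def by measurable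
qed

text \<open>The event is split by the state at time \<open>n\<close>, which lies in \<open>S\<close>
  because the chain is still alive. The final step is free of the taboo: \<open>y = z\<close> gives
  the return probabilities, other \<open>y\<close> the recursion of
  \<open>taboo_prob\<close>.\<close>

lemma emeasure_avoids_Suc:
  assumes x: "x \<in> S" and y: "y \<in> S"
  defines "M \<equiv> Pr (Some x)"
  shows "emeasure M {\<omega>\<in>space M. avoids z n (\<lambda>i. X i \<omega>) \<and> X (Suc n) \<omega> = Some y}
    = (\<integral>\<^sup>+w. emeasure M {\<omega>\<in>space M. avoids z n (\<lambda>i. X i \<omega>) \<and> X n \<omega> = Some w} * ennreal (B w y)
        \<partial>count_space S)"
proof -
  have mc: "markov_chain (ext_states S) (ext_matrix S B) M X"
    using mf x by (simp add: markov_family_def ext_states_def M_def)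
  have E: "countable (ext_states S)" using S by (simp add: ext_states_def)
  have XS: "X n \<omega> \<in> ext_states S" if "\<omega> \<in> space M" for \<omega>
    using mc measurable_space[OF _ that, of "X n" "count_space (ext_states S)"]
    by (simp add: markov_chain_def)
  define A where "A w = {\<omega>\<in>space M. avoids z n (\<lambda>i. X i \<omega>) \<and> X n \<omega> = Some w \<and> X (Suc n) \<omega> = Some y}" for w
  have A: "A w \<in> sets M" for w
  proof -
    have "A w = {\<omega>\<in>space M. avoids z n (\<lambda>i. X i \<omega>) \<and> X n \<omega> = Some w}
        \<inter> {\<omega>\<in>space M. avoids z n (\<lambda>i. X i \<omega>) \<and> X (Suc n) \<omega> = Some y}"
      by (auto simp: A_def)
    then show ?thesis using measurable_history[OF x] by (simp add: M_def sets.Int)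
  qed
  have "{\<omega>\<in>space M. avoids z n (\<lambda>i. X i \<omega>) \<and> X (Suc n) \<omega> = Some y} = (\<Union>w\<in>S. A w)"
    using XS by (fastforce simp: A_def avoids_def ext_states_def)
  also have "emeasure M \<dots> = (\<integral>\<^sup>+w. emeasure M (A w) \<partial>count_space S)"
    using A S by (intro emeasure_UN_countable) (auto simp: disjoint_family_on_def A_def)
  also have "\<dots> = (\<integral>\<^sup>+w. emeasure M {\<omega>\<in>space M. avoids z n (\<lambda>i. X i \<omega>) \<and> X n \<omega> = Some w}
      * ennreal (B w y) \<partial>count_space S)"
    using markov_chain_step[OF mc E, of "Some _" "Some y" "avoids z n" n] y
    by (intro nn_integral_cong) (simp add: A_def avoids_restrict ext_states_def)
  finally show ?thesis .
qed

text \<open>Both sides obey the same last-step recursion, and at positive times both vanish for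
  \<open>y = z\<close>. At time 0 the initial law is the point mass at \<open>x\<close>.\<close>

lemma emeasure_avoids:
  assumes x: "x \<in> S" and y: "y \<in> S"
  defines "M \<equiv> Pr (Some x)"
  shows "emeasure M {\<omega>\<in>space M. avoids z n (\<lambda>i. X i \<omega>) \<and> X n \<omega> = Some y} = taboo_prob S B z n x y"
  using y
proof (induction n arbitrary: y)
  case 0
  interpret prob_space M
    using mf x by (simp add: markov_family_def markov_chain_def ext_states_def M_def)
  have 1: "prob {\<omega>\<in>space M. X 0 \<omega> = Some x} = 1"
    using mf x by (simp add: markov_family_def ext_states_def M_def)
  have meas: "{\<omega>\<in>space M. avoids z 0 (\<lambda>i. X i \<omega>) \<and> X 0 \<omega> = Some y} \<in> sets M" for y
    using measurable_history[OF x] by (simp add: M_def)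
  have eq: "{\<omega>\<in>space M. avoids z 0 (\<lambda>i. X i \<omega>) \<and> X 0 \<omega> = Some y} = {\<omega>\<in>space M. X 0 \<omega> = Some y}" for y
    by (auto simp: avoids_def)
  show ?case
  proof (cases "x = y")
    case True
    then show ?thesis using 1 by (simp add: eq emeasure_eq_measure)
  next
    case False
    have "AE \<omega> in M. \<omega> \<in> {\<omega>\<in>space M. X 0 \<omega> = Some x}"
      using 1 meas by (subst prob_eq_1[symmetric]) (simp_all add: eq)
    then have "AE \<omega> in M. \<omega> \<notin> {\<omega>\<in>space M. X 0 \<omega> = Some y}"
      by eventually_elim (use False in auto)
    then show ?thesis using False meas[of y] by (simp add: eq emeasure_eq_measure prob_eq_0)
  qed
next
  case (Suc n)
  show ?case
  proof (cases "y = z")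
    case True
    then show ?thesis by (simp add: avoids_Suc)
  next
    case False
    then have "{\<omega>\<in>space M. avoids z (Suc n) (\<lambda>i. X i \<omega>) \<and> X (Suc n) \<omega> = Some y}
        = {\<omega>\<in>space M. avoids z n (\<lambda>i. X i \<omega>) \<and> X (Suc n) \<omega> = Some y}"
      by (auto simp: avoids_Suc)
    then show ?thesis
      using emeasure_avoids_Suc[OF x Suc.prems, of n] False Suc.IH
      by (auto simp: M_def intro!: nn_integral_cong)
  qed
qed

text \<open>The expectation is split over the value k + 1 of \<tau>. Returning at that time means k
  taboo steps followed by one step into \<open>z\<close>; duality turns this forward sum into K^k
  applied to the column of \<open>z\<close> in \<open>B\<close>.\<close>

lemma u_star_eq_suminf:
  assumes x: "x \<in> S"
  shows "u_star Pr X z \<theta> x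
    = (\<Sum>k. ennreal (exp (\<theta> * real (Suc k))) * (taboo_op S B z ^^ k) (\<lambda>w. ennreal (B w z)) x)"
proof -
  define M where "M = Pr (Some x)"
  define C where "C k = {\<omega>\<in>space M. avoids z k (\<lambda>i. X i \<omega>) \<and> X (Suc k) \<omega> = Some z}" for k
  have C [measurable]: "C k \<in> sets M" for k
    using measurable_history[OF x] by (simp add: C_def M_def)
  have EC: "emeasure M (C k) = (taboo_op S B z ^^ k) (\<lambda>w. ennreal (B w z)) x" for k
    unfolding taboo_prob_duality[OF S x, symmetric]
    using emeasure_avoids_Suc[OF x z, of k] emeasure_avoids[OF x, of _ k]
    by (auto simp: C_def M_def intro!: nn_integral_cong)
  have "u_star Pr X z \<theta> x = (\<integral>\<^sup>+\<omega>. (\<Sum>k. ennreal (exp (\<theta> * real (Suc k))) * indicator (C k) \<omega>) \<partial>M)"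
    unfolding u_star_def M_def[symmetric]
      return_before_death_suminf[where c = "\<lambda>n. ennreal (exp (\<theta> * real n))"]
    by (intro nn_integral_cong arg_cong[where f = suminf] ext) (auto simp: C_def)
  also have "\<dots> = (\<Sum>k. ennreal (exp (\<theta> * real (Suc k))) * emeasure M (C k))"
    by (subst nn_integral_suminf) (simp_all add: nn_integral_cmult)
  finally show ?thesis by (simp add: EC)
qed

lemma eta_star_eq_suminf:
  assumes y: "y \<in> S"
  shows "eta_star Pr X z \<theta> y = (\<Sum>j. ennreal (exp (\<theta> * real j)) * taboo_prob S B z j z y)"
proof -
  define M where "M = Pr (Some z)"
  define A where "A j = {\<omega>\<in>space M. avoids z j (\<lambda>i. X i \<omega>) \<and> X j \<omega> = Some y}" for j
  have A [measurable]: "A j \<in> sets M" for j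
    using measurable_history[OF z] by (simp add: A_def M_def)
  have EA: "emeasure M (A j) = taboo_prob S B z j z y" for j
    using emeasure_avoids[OF z y, of j] by (simp add: A_def M_def)
  have "eta_star Pr X z \<theta> y = (\<integral>\<^sup>+\<omega>. (\<Sum>j. ennreal (exp (\<theta> * real j)) * indicator (A j) \<omega>) \<partial>M)"
    unfolding eta_star_def M_def[symmetric]
    by (intro nn_integral_cong arg_cong[where f = suminf] ext) (auto simp: A_def avoids_iff_times)
  also have "\<dots> = (\<Sum>j. ennreal (exp (\<theta> * real j)) * emeasure M (A j))"
    by (subst nn_integral_suminf) (simp_all add: nn_integral_cmult)
  finally show ?thesis by (simp add: EA)
qed

end

section \<open>Eigenvector equations, positivity and finiteness\<close>

lemma ennreal_exp_mult: "ennreal (exp a) * (ennreal (exp b) * c) = ennreal (exp (a + b)) * c"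
  by (simp add: exp_add ennreal_mult mult.assoc)

theorem theorem1:
  fixes S :: "'a set" and B :: "'a \<Rightarrow> 'a \<Rightarrow> real" and z :: 'a and \<theta> :: real
    and Pr :: "'a option \<Rightarrow> 'w measure" and X :: "nat \<Rightarrow> 'w \<Rightarrow> 'a option"
  assumes "countable S"
    and "sub_stochastic S B"
    and "irreducible_matrix S B"
    and "z \<in> S"
    and "markov_family (ext_states S) (ext_matrix S B) Pr X"
    and "0 \<le> \<theta>"
    and "u_star Pr X z \<theta> z = 1"
  shows "(\<forall>x\<in>S. 0 < u_star Pr X z \<theta> x \<and> u_star Pr X z \<theta> x < \<infinity>) \<and>
    (\<forall>y\<in>S. 0 < eta_star Pr X z \<theta> y \<and> eta_star Pr X z \<theta> y < \<infinity>) \<and>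
    (\<forall>x\<in>S. mat_col S B (u_star Pr X z \<theta>) x = ennreal (exp (- \<theta>)) * u_star Pr X z \<theta> x) \<and>
    (\<forall>y\<in>S. row_mat S (eta_star Pr X z \<theta>) B y = ennreal (exp (- \<theta>)) * eta_star Pr X z \<theta> y)"
proof -
  note S = assms(1) and z = assms(4)
  note u_eq = u_star_eq_suminf[OF S z assms(5)] and eta_eq = eta_star_eq_suminf[OF S z assms(5)]
  let ?u = "u_star Pr X z \<theta>" and ?eta = "eta_star Pr X z \<theta>"
  \<comment> \<open>On \<open>S\<close>, \<open>F k x\<close> is the probability from
    \<open>x\<close> of \<tau> = k + 1 < T, and \<open>T j y\<close> is the probability from
    \<open>z\<close> of being at \<open>y\<close> at time j with both \<tau> and the death time
    beyond j.\<close>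
  define F where "F k = (taboo_op S B z ^^ k) (\<lambda>w. ennreal (B w z))" for k
  define T where "T j = taboo_prob S B z j z" for j
  have F_Suc: "F (Suc k) = taboo_op S B z (F k)" for k by (simp add: F_def)
  have u: "?u x = (\<Sum>k. ennreal (exp (\<theta> * real (Suc k))) * F k x)" if "x \<in> S" for x
    using u_eq[OF that] by (simp add: F_def)
  have eta: "?eta y = (\<Sum>j. ennreal (exp (\<theta> * real j)) * T j y)" if "y \<in> S" for y
    using eta_eq[OF that] by (simp add: T_def)
  have lam_u: "ennreal (exp (- \<theta>)) * ?u x = (\<Sum>k. ennreal (exp (\<theta> * real k)) * F k x)"
    if "x \<in> S" for x
    by (simp add: u[OF that] ennreal_suminf_cmult[symmetric] ennreal_exp_mult distrib_left del: of_nat_Suc)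
      (simp add: algebra_simps)
  have col: "mat_col S B ?u x = ennreal (exp (- \<theta>)) * ?u x" if x: "x \<in> S" for x
  proof -
    have "mat_col S B ?u x = (\<integral>\<^sup>+y. ennreal (B x y) * ?u y \<partial>count_space S)"
      by (simp add: mat_col_def infsum_ennreal_eq_nn_integral[OF S])
    also have "\<dots> = (\<integral>\<^sup>+y. (if y = z then ennreal (B x y) * ?u y else 0)
        + ennreal (B x y) * (if y = z then 0 else ?u y) \<partial>count_space S)"
      by (intro nn_integral_cong) auto
    \<comment> \<open>The state \<open>z\<close> contributes B(x,z) because \<open>u_star\<close>
      equals 1 there; this is the k = 0 term that the shifted series from K leaves out.\<close>
    also have "\<dots> = F 0 x + taboo_op S B z ?u x"
      by (simp add: nn_integral_add nn_integral_count_space_delta[OF z] assms(7) taboo_op_def F_def)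
    also have "taboo_op S B z ?u x
        = taboo_op S B z (\<lambda>y. \<Sum>k. ennreal (exp (\<theta> * real (Suc k))) * F k y) x"
      unfolding taboo_op_def by (intro nn_integral_cong) (simp add: u del: of_nat_Suc)
    also have "\<dots> = (\<Sum>k. ennreal (exp (\<theta> * real (Suc k))) * F (Suc k) x)"
      unfolding taboo_op_suminf taboo_op_cmult F_Suc ..
    also have "F 0 x + \<dots> = (\<Sum>k. ennreal (exp (\<theta> * real k)) * F k x)"
      by (subst suminf_split_head_ennreal[of "\<lambda>k. ennreal (exp (\<theta> * real k)) * F k x"]) simp
    finally show ?thesis using lam_u[OF x] by simp
  qed
  have T0: "T 0 y = (if y = z then 1 else 0)" for y by (simp add: T_def)
  \<comment> \<open>The taboo kills every term with j > 0, leaving only the start at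
    \<open>z\<close>.\<close>
  have eta_z: "?eta z = 1"
    by (simp add: eta[OF z] T_def suminf_split_head_ennreal[of "\<lambda>j. _ j * taboo_prob S B z j z z"])
  have row: "row_mat S ?eta B y = ennreal (exp (- \<theta>)) * ?eta y" if y: "y \<in> S" for y
  proof -
    have "row_mat S ?eta B y = (\<integral>\<^sup>+x. ?eta x * ennreal (B x y) \<partial>count_space S)"
      by (simp add: row_mat_def infsum_ennreal_eq_nn_integral[OF S])
    also have "\<dots> = (\<integral>\<^sup>+x. (\<Sum>j. ennreal (exp (\<theta> * real j)) * (T j x * ennreal (B x y))) \<partial>count_space S)"
      by (intro nn_integral_cong) (simp add: eta ennreal_suminf_multc[symmetric] mult.assoc)
    also have "\<dots> = (\<Sum>j. ennreal (exp (\<theta> * real j)) * (\<integral>\<^sup>+x. T j x * ennreal (B x y) \<partial>count_space S))"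
      by (simp add: nn_integral_suminf nn_integral_cmult)
    finally have *: "row_mat S ?eta B y = \<dots>" .
    show ?thesis
    proof (cases "y = z")
      case True
      \<comment> \<open>At \<open>z\<close> the row sum becomes the return series, equal to
        \<lambda> times \<open>u_star\<close> at \<open>z\<close>; the hypothesis and
        \<open>eta_z\<close> make both vectors 1 there.\<close>
      have "(\<integral>\<^sup>+x. T j x * ennreal (B x z) \<partial>count_space S) = F j z" for j
        unfolding T_def F_def by (rule taboo_prob_duality[OF S z])
      then show ?thesis using * True lam_u[OF z] assms(7) eta_z by simp
    next
      case False
      \<comment> \<open>Away from \<open>z\<close> the j = 0 term is zero, so the shift leaves no
        boundary term.\<close>
      have "?eta y = (\<Sum>j. ennreal (exp (\<theta> * real (Suc j))) * T (Suc j) y)"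
        using False by (simp add: eta[OF y] T0 suminf_split_head_ennreal[of "\<lambda>j. _ j * T j y"])
      moreover have "T (Suc j) y = (\<integral>\<^sup>+x. T j x * ennreal (B x y) \<partial>count_space S)" for j
        using False by (simp add: T_def)
      ultimately show ?thesis
        using * by (simp add: ennreal_suminf_cmult[symmetric] ennreal_exp_mult del: of_nat_Suc)
          (simp add: algebra_simps)
    qed
  qed
  define R where "R = {(v, w). v \<in> S \<and> w \<in> S \<and> 0 < B v w}"
  have reach: "(x, y) \<in> R\<^sup>*" if "x \<in> S" "y \<in> S" for x y
    using assms(3) that mat_pow_pos_path[OF assms(2) that(2,1)]
    unfolding irreducible_matrix_def R_def by blast
  have u_le: "ennreal (B x w) * ?u w \<le> ennreal (exp (- \<theta>)) * ?u x" if "x \<in> S" "w \<in> S" for x w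
    using nn_integral_ge_point[OF that(2), of "\<lambda>y. ennreal (B x y) * ?u y"] col[OF that(1)]
    by (simp add: mat_col_def infsum_ennreal_eq_nn_integral[OF S])
  have eta_le: "?eta x * ennreal (B x w) \<le> ennreal (exp (- \<theta>)) * ?eta w" if "x \<in> S" "w \<in> S" for x w
    using nn_integral_ge_point[OF that(1), of "\<lambda>x. ?eta x * ennreal (B x w)"] row[OF that(2)]
    by (simp add: row_mat_def infsum_ennreal_eq_nn_integral[OF S])
  \<comment> \<open>Along an edge from x to w, \<open>u_le\<close> carries positivity back from w to
    x and finiteness forward from x to w, hence the opposite path directions in \<open>u_pos\<close>
    and \<open>u_fin\<close>.\<close>
  have u_pos: "0 < ?u x" if "(x, z) \<in> R\<^sup>*" for x
    using that
  proof (induction rule: converse_rtrancl_induct)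
    case (step x w)
    then have "0 < ennreal (B x w) * ?u w" by (simp add: R_def ennreal_zero_less_mult_iff)
    also have "\<dots> \<le> ennreal (exp (- \<theta>)) * ?u x" using step by (intro u_le) (auto simp: R_def)
    finally show ?case by (simp add: ennreal_zero_less_mult_iff)
  qed (simp add: assms(7))
  have u_fin: "?u y < \<infinity>" if "(z, y) \<in> R\<^sup>*" for y
    using that
  proof (induction rule: rtrancl_induct)
    case (step x w)
    have "ennreal (B x w) * ?u w \<le> ennreal (exp (- \<theta>)) * ?u x"
      using step by (intro u_le) (auto simp: R_def)
    also have "\<dots> < \<infinity>" using step by (simp add: ennreal_mult_less_top)
    finally show ?case using step by (auto simp: ennreal_mult_less_top R_def)
  qed (simp add: assms(7))
  \<comment> \<open>For the row vector the directions are reversed: \<open>eta_le\<close> carries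
    positivity forward and finiteness back.\<close>
  have eta_pos: "0 < ?eta y" if "(z, y) \<in> R\<^sup>*" for y
    using that
  proof (induction rule: rtrancl_induct)
    case (step x w)
    then have "0 < ?eta x * ennreal (B x w)" by (simp add: R_def ennreal_zero_less_mult_iff)
    also have "\<dots> \<le> ennreal (exp (- \<theta>)) * ?eta w" using step by (intro eta_le) (auto simp: R_def)
    finally show ?case by (simp add: ennreal_zero_less_mult_iff)
  qed (simp add: eta_z)
  have eta_fin: "?eta x < \<infinity>" if "(x, z) \<in> R\<^sup>*" for x
    using that
  proof (induction rule: converse_rtrancl_induct)
    case (step x w)
    have "?eta x * ennreal (B x w) \<le> ennreal (exp (- \<theta>)) * ?eta w"
      using step by (intro eta_le) (auto simp: R_def)
    also have "\<dots> < \<infinity>" using step by (simp add: ennreal_mult_less_top)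
    finally show ?case using step by (auto simp: ennreal_mult_less_top R_def)
  qed (simp add: eta_z)
  show ?thesis
    using u_pos[OF reach[OF _ z]] u_fin[OF reach[OF z]] eta_pos[OF reach[OF z]]
      eta_fin[OF reach[OF _ z]] col row by simp
qed

end
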